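(* (1) Every disk graph $G$ contains a balanced separator $S$ such that $G[S]$ is a linear disk graph. (2) Every linear disk graph $G$ contains a balanced separator $S$ which can be partitioned into sets $V_1,\dots,V_5$ such that $G[V_i]$ is a $\Delta$-disk graph for each $1\leq i\leq 4$ and $G[V_5]$ is a clique.
   Context: A disk graph is the intersection graph of a finite family of closed disks in the plane; such a family $\{D_v=D((x_v,y_v),r_v)\}$ (center $(x_v,y_v)$, radius $r_v$) is a disk representation. A subset $S\subseteq V(G)$ of an $n$-vertex graph is a balanced separator if $V(G)\setminus S$ can be partitioned into two sets $A,B$, each of size at most $\lceil n/2\rceil$, with no edge between $A$ and $B$. A disk graph is a linear disk graph if it has a disk representation and a line in the plane that intersects every disk of the representation. A disk graph is a $\Delta$-disk graph if it has a disk representation such that for every vertex $v$, $x_v>0$, $y_v>0$ and $\max(x_v,y_v)\leq r_v<\sqrt{x_v^2+y_v^2}$ (each disk meets both coordinate axes but does not contain the origin). *)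

theory Defs
  imports "HOL-Analysis.Analysis" "Graph_Theory.Graph_Theory"
begin

text \<open>
  A finite simple undirected graph is a pre-digraph satisfying \<^locale>\<open>graph\<close>: finite,
  loop-free, without parallel arcs, and with a symmetric adjacency relation, each edge being a
  pair of opposite arcs. The plane is \<^typ>\<open>real \<times> real\<close>, whose product metric is Euclidean.
\<close>

definition disk_representation ::
  "('a, 'b) pre_digraph \<Rightarrow> ('a \<Rightarrow> real) \<Rightarrow> ('a \<Rightarrow> real) \<Rightarrow> ('a \<Rightarrow> real) \<Rightarrow> bool" where
  "disk_representation G x y r \<longleftrightarrow>
     (\<forall>v\<in>verts G. 0 < r v) \<and>
     (\<forall>u\<in>verts G. \<forall>v\<in>verts G. u \<noteq> v \<longrightarrow>
        (u \<rightarrow>\<^bsub>G\<^esub> v \<longleftrightarrow> cball (x u, y u) (r u) \<inter> cball (x v, y v) (r v) \<noteq> {}))"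

definition disk_graph :: "('a, 'b) pre_digraph \<Rightarrow> bool" where
  "disk_graph G \<longleftrightarrow> graph G \<and> (\<exists>x y r. disk_representation G x y r)"

definition is_line :: "(real \<times> real) set \<Rightarrow> bool" where
  "is_line L \<longleftrightarrow> affine L \<and> aff_dim L = 1"

definition linear_disk_graph :: "('a, 'b) pre_digraph \<Rightarrow> bool" where
  "linear_disk_graph G \<longleftrightarrow> graph G \<and>
     (\<exists>x y r L. disk_representation G x y r \<and> is_line L \<and>
        (\<forall>v\<in>verts G. cball (x v, y v) (r v) \<inter> L \<noteq> {}))"

definition Delta_disk_graph :: "('a, 'b) pre_digraph \<Rightarrow> bool" where
  "Delta_disk_graph G \<longleftrightarrow> graph G \<and>
     (\<exists>x y r. disk_representation G x y r \<and>
        (\<forall>v\<in>verts G. 0 < x v \<and> 0 < y v \<and>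
           max (x v) (y v) \<le> r v \<and> r v < sqrt ((x v)\<^sup>2 + (y v)\<^sup>2)))"

definition balanced_separator :: "('a, 'b) pre_digraph \<Rightarrow> 'a set \<Rightarrow> bool" where
  "balanced_separator G S \<longleftrightarrow> S \<subseteq> verts G \<and>
     (\<exists>A B. A \<union> B = verts G - S \<and> A \<inter> B = {} \<and>
        int (card A) \<le> \<lceil>real (card (verts G)) / 2\<rceil> \<and>
        int (card B) \<le> \<lceil>real (card (verts G)) / 2\<rceil> \<and>
        (\<forall>a\<in>A. \<forall>b\<in>B. \<not> a \<rightarrow>\<^bsub>G\<^esub> b \<and> \<not> b \<rightarrow>\<^bsub>G\<^esub> a))"

end

theory Submission
  imports Defs
begin

text \<open>
  A vertical line through a median of the centres' abscissae has at most half of the disks strictly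
  on either side, so the disks meeting it form a balanced separator. If moreover all disks meet a
  line, rotate it to the horizontal axis: the separating disks then meet both of two perpendicular
  lines. Those containing the crossing point pairwise intersect. The centre of any other one lies on
  neither line, and reflecting its open quadrant onto the positive one gives a
  \<open>\<Delta>\<close>-representation.
\<close>

section \<open>Disk representations in terms of distances between centres\<close>

lemma cball_Int_cball_nonempty_iff:
  fixes a b :: "'a::real_normed_vector"
  assumes "0 < r" "0 < s"
  shows "cball a r \<inter> cball b s \<noteq> {} \<longleftrightarrow> dist a b \<le> r + s"
proof
  show "dist a b \<le> r + s" if "cball a r \<inter> cball b s \<noteq> {}"
    using that disjoint_cballI[of r s a b] by force
next
  assume le: "dist a b \<le> r + s"
  \<comment> \<open>The point dividing the segment from \<open>a\<close> to \<open>b\<close> in the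
    ratio \<open>r : s\<close>; its distances to the ends are the fractions
    \<open>r / (r + s)\<close> and \<open>s / (r + s)\<close> of \<open>dist a b\<close>.\<close>
  define p where "p = a + (r / (r + s)) *\<^sub>R (b - a)"
  have "a - p = (- (r / (r + s))) *\<^sub>R (b - a)"
    by (simp add: p_def)
  then have "dist a p = r / (r + s) * dist a b"
    using assms by (simp add: dist_norm norm_minus_commute)
  also have "\<dots> \<le> r / (r + s) * (r + s)"
    using assms le by (intro mult_left_mono) auto
  finally have 1: "dist a p \<le> r"
    using assms by simp
  have "b - p = (1 - r / (r + s)) *\<^sub>R (b - a)"
    by (simp add: p_def algebra_simps)
  also have "1 - r / (r + s) = s / (r + s)"
    using assms by (simp add: field_simps)
  finally have "dist b p = s / (r + s) * dist a b"
    using assms by (simp add: dist_norm norm_minus_commute)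
  also have "\<dots> \<le> s / (r + s) * (r + s)"
    using assms le by (intro mult_left_mono) auto
  finally have 2: "dist b p \<le> s"
    using assms by simp
  from 1 2 have "p \<in> cball a r \<inter> cball b s"
    by simp
  then show "cball a r \<inter> cball b s \<noteq> {}"
    by blast
qed

lemma disk_representation_iff_dist:
  "disk_representation G x y r \<longleftrightarrow>
     (\<forall>v\<in>verts G. 0 < r v) \<and>
     (\<forall>u\<in>verts G. \<forall>v\<in>verts G. u \<noteq> v \<longrightarrow>
        (u \<rightarrow>\<^bsub>G\<^esub> v \<longleftrightarrow> dist (x u, y u) (x v, y v) \<le> r u + r v))"
  unfolding disk_representation_def
  by (intro conj_cong refl ball_cong imp_cong) (simp add: cball_Int_cball_nonempty_iff)

text \<open>With the radii kept, adjacency depends only on the distances between centres. This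
  covers the rotation, translation and reflections used below.\<close>

lemma disk_representation_isometric:
  assumes "disk_representation G x y r"
    and "\<And>u v. dist (x' u, y' u) (x' v, y' v) = dist (x u, y u) (x v, y v)"
  shows "disk_representation G x' y' r"
  using assms by (simp add: disk_representation_iff_dist)

lemma dominates_induce_subgraph_iff:
  "u \<rightarrow>\<^bsub>G \<restriction> S\<^esub> v \<longleftrightarrow> u \<in> S \<and> v \<in> S \<and> u \<rightarrow>\<^bsub>G\<^esub> v"
  by (auto simp: arcs_ends_def arc_to_ends_def)

lemma disk_representation_induce_subgraph:
  assumes "disk_representation G x y r" "S \<subseteq> verts G"
  shows "disk_representation (G \<restriction> S) x y r"
  using assms unfolding disk_representation_iff_dist
  by (auto simp: dominates_induce_subgraph_iff subset_iff)

lemma graph_induce_subgraph: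
  assumes "graph G" "S \<subseteq> verts G"
  shows "graph (G \<restriction> S)"
proof -
  interpret graph G by fact
  have "symmetric (G \<restriction> S)"
    using sym_arcs unfolding symmetric_def sym_def by (simp add: dominates_induce_subgraph_iff)
  moreover have "finite S"
    using assms(2) finite_verts finite_subset by blast
  ultimately show ?thesis
    by unfold_locales (auto simp: no_loops no_multi_arcs)
qed

section \<open>Medians and separation by a vertical line\<close>

lemma median_exists:
  fixes f :: "'a \<Rightarrow> real"
  assumes "finite V"
  obtains c where "2 * card {v \<in> V. c < f v} \<le> card V" "2 * card {v \<in> V. f v < c} \<le> card V"
proof (cases "V = {}")
  case True
  then show ?thesis using that[of 0] by simp
next
  case False
  \<comment> \<open>Values of \<open>f\<close> with at most half of \<open>V\<close> strictly above
    them. The least one will be the median.\<close>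
  define M where "M = {m \<in> f ` V. 2 * card {v \<in> V. m < f v} \<le> card V}"
  have "finite M"
    using assms by (simp add: M_def)
  have empty: "{v \<in> V. Max (f ` V) < f v} = {}"
    using assms by (auto simp: not_less)
  have "Max (f ` V) \<in> f ` V"
    using assms False by (intro Max_in) auto
  then have "Max (f ` V) \<in> M"
    unfolding M_def mem_Collect_eq empty by simp
  then have "Min M \<in> M"
    using \<open>finite M\<close> by (intro Min_in) auto
  have below: "2 * card {v \<in> V. f v < Min M} \<le> card V"
  proof (cases "{v \<in> V. f v < Min M} = {}")
    case True
    then show ?thesis by (simp only: card.empty)
  next
    case nonempty: False
    define W where "W = {v \<in> V. f v < Min M}"
    have "finite W" "W \<noteq> {}"
      using assms nonempty by (auto simp: W_def)
    then have "Max (f ` W) \<in> f ` W"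
      by (intro Max_in) auto
    \<comment> \<open>\<open>w\<close> attains the largest value below \<open>Min M\<close>. By
      minimality more than half of \<open>V\<close> lies strictly above \<open>f w\<close>, and
      \<open>W\<close> is disjoint from that part.\<close>
    then obtain w where w: "w \<in> W" "f w = Max (f ` W)"
      by auto
    define U where "U = {v \<in> V. f w < f v}"
    have "f w \<notin> M"
      using w Min_le[OF \<open>finite M\<close>] by (force simp: W_def)
    moreover have "f w \<in> f ` V"
      using w(1) by (simp add: W_def)
    ultimately have "card V < 2 * card U"
      unfolding M_def U_def by simp
    moreover have "f v \<le> f w" if "v \<in> W" for v
      using w(2) \<open>finite W\<close> that by simp
    then have "W \<inter> U = {}"
      by (force simp: U_def)
    then have "card W + card U = card (W \<union> U)"
      using assms by (subst card_Un_disjoint) (auto simp: W_def U_def)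
    moreover have "card (W \<union> U) \<le> card V"
      using assms by (intro card_mono) (auto simp: W_def U_def)
    ultimately show ?thesis
      by (simp add: W_def)
  qed
  show ?thesis
    using \<open>Min M \<in> M\<close> below by (intro that[of "Min M"]) (simp_all add: M_def)
qed

text \<open>Radii are positive, so a disk strictly to one side of the median line has its centre
  there, and the median bounds the number of such disks. For disks on opposite sides, the abscissae
  of the centres already differ by more than the sum of the radii.\<close>

lemma balanced_separator_vertical_line:
  assumes "graph G" and rep: "disk_representation G x y r"
  obtains c where "balanced_separator G {v \<in> verts G. \<bar>x v - c\<bar> \<le> r v}"
proof -
  interpret graph G by fact
  obtain c where c: "2 * card {v \<in> verts G. c < x v} \<le> card (verts G)"
    "2 * card {v \<in> verts G. x v < c} \<le> card (verts G)"
    by (rule median_exists[OF finite_verts])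
  define A where "A = {v \<in> verts G. c < x v - r v}"
  define B where "B = {v \<in> verts G. x v + r v < c}"
  have pos: "0 < r v" if "v \<in> verts G" for v
    using rep that by (simp add: disk_representation_iff_dist)
  have ceil: "int k \<le> \<lceil>real (card (verts G)) / 2\<rceil>" if "2 * k \<le> card (verts G)" for k
    using that by linarith
  have "card A \<le> card {v \<in> verts G. c < x v}" "card B \<le> card {v \<in> verts G. x v < c}"
    using pos by (auto intro!: card_mono simp: A_def B_def) (smt (verit))+
  then have cards: "2 * card A \<le> card (verts G)" "2 * card B \<le> card (verts G)"
    using c by linarith+
  have sep: "\<not> a \<rightarrow>\<^bsub>G\<^esub> b \<and> \<not> b \<rightarrow>\<^bsub>G\<^esub> a" if "a \<in> A" "b \<in> B" for a b
  proof -
    have ab: "a \<in> verts G" "b \<in> verts G" "r a + r b < x a - x b"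
      using that by (auto simp: A_def B_def)
    have "x a - x b \<le> dist (x a, y a) (x b, y b)"
      using dist_fst_le[of "(x a, y a)" "(x b, y b)"] by (simp add: dist_real_def)
    with ab have "r a + r b < dist (x a, y a) (x b, y b)"
      by linarith
    moreover have "a \<noteq> b"
      using ab pos[of a] by force
    ultimately show ?thesis
      using ab rep by (auto simp: disk_representation_iff_dist dist_commute add.commute)
  qed
  have "A \<union> B = verts G - {v \<in> verts G. \<bar>x v - c\<bar> \<le> r v}" "A \<inter> B = {}"
    using pos by (auto simp: A_def B_def abs_le_iff) (smt (verit))+
  then have "balanced_separator G {v \<in> verts G. \<bar>x v - c\<bar> \<le> r v}"
    unfolding balanced_separator_def using ceil[OF cards(1)] ceil[OF cards(2)] sep
    by (intro conjI exI[of _ A] exI[of _ B]) auto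
  then show ?thesis
    by (rule that)
qed

section \<open>Lines, and rotation of a given line to the horizontal axis\<close>

lemma is_line_vertical: "is_line {p. fst p = c}"
proof -
  have "{p :: real \<times> real. fst p = c} = affine hull {(c, 0), (c, 1)}"
    by (auto simp: affine_hull_2_alt image_iff)
  then show ?thesis
    by (simp add: is_line_def)
qed

text \<open>An affine basis of a set of dimension 1 has exactly two points.\<close>

lemma is_line_affine_hull_2E:
  assumes "is_line L"
  obtains a b where "a \<noteq> b" "L = affine hull {a, b}"
proof -
  obtain B where B: "affine hull B = affine hull L" "int (card B) = aff_dim L + 1"
    using aff_dim_basis_exists[of L] by auto
  then have "card B = 2"
    using assms by (simp add: is_line_def)
  then obtain a b where "B = {a, b}" "a \<noteq> b"
    by (auto simp: card_2_iff)
  moreover have "affine hull L = L"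
    using assms by (simp add: is_line_def affine_hull_eq)
  ultimately show ?thesis
    using B(1) that by metis
qed

text \<open>The bound on \<open>y v\<close> says that the disk of \<open>v\<close> meets the
  horizontal axis. It comes from expressing the centres in an orthonormal frame whose first vector
  is a direction of the given line.\<close>

lemma linear_disk_graph_horizontal:
  assumes "linear_disk_graph G"
  obtains x y r where "disk_representation G x y r" "\<And>v. v \<in> verts G \<Longrightarrow> \<bar>y v\<bar> \<le> r v"
proof -
  obtain x y r L where rep: "disk_representation G x y r" and "is_line L"
    and meets: "\<And>v. v \<in> verts G \<Longrightarrow> cball (x v, y v) (r v) \<inter> L \<noteq> {}"
    using assms unfolding linear_disk_graph_def by blast
  then obtain a b where ab: "a \<noteq> b" "L = affine hull {a, b}"
    by (meson is_line_affine_hull_2E)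
  obtain a1 a2 b1 b2 where a: "a = (a1, a2)" and b: "b = (b1, b2)"
    by (cases a, cases b)
  define l where "l = norm (b - a)"
  have "l > 0"
    using ab by (simp add: l_def)
  define d1 d2 where "d1 = (b1 - a1) / l" and "d2 = (b2 - a2) / l"
  have "l\<^sup>2 = (b1 - a1)\<^sup>2 + (b2 - a2)\<^sup>2"
    by (simp add: l_def a b norm_prod_def)
  then have "d1\<^sup>2 + d2\<^sup>2 = l\<^sup>2 / l\<^sup>2"
    by (simp only: d1_def d2_def power_divide add_divide_distrib)
  then have unit: "d1\<^sup>2 + d2\<^sup>2 = 1"
    using \<open>l > 0\<close> by simp
  \<comment> \<open>The two-squares identity. It serves twice: to show that the change of frame is
    an isometry, and to bound a normal component by the length of the vector.\<close>
  have rot: "(s * d1 + t * d2)\<^sup>2 + (t * d1 - s * d2)\<^sup>2 = s\<^sup>2 + t\<^sup>2" for s t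
  proof -
    have "(s * d1 + t * d2)\<^sup>2 + (t * d1 - s * d2)\<^sup>2 = (s\<^sup>2 + t\<^sup>2) * (d1\<^sup>2 + d2\<^sup>2)"
      by algebra
    then show ?thesis
      by (simp add: unit)
  qed
  \<comment> \<open>Coordinates relative to \<open>a\<close> in the frame \<open>(d1, d2)\<close>,
    \<open>(- d2, d1)\<close>; thus \<open>y' v\<close> is the signed distance of the centre from
    \<open>L\<close>.\<close>
  define x' where "x' v = (x v - a1) * d1 + (y v - a2) * d2" for v
  define y' where "y' v = (y v - a2) * d1 - (x v - a1) * d2" for v
  have "disk_representation G x' y' r"
  proof (rule disk_representation_isometric[OF rep])
    fix u v
    have "x' u - x' v = (x u - x v) * d1 + (y u - y v) * d2"
      "y' u - y' v = (y u - y v) * d1 - (x u - x v) * d2"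
      by (simp_all add: x'_def y'_def algebra_simps)
    then show "dist (x' u, y' u) (x' v, y' v) = dist (x u, y u) (x v, y v)"
      by (simp add: dist_Pair_Pair dist_real_def rot)
  qed
  moreover have "\<bar>y' v\<bar> \<le> r v" if v: "v \<in> verts G" for v
  proof -
    obtain t where "a + t *\<^sub>R (b - a) \<in> cball (x v, y v) (r v)"
      using meets[OF v] by (auto simp: ab(2) affine_hull_2_alt)
    then have "sqrt ((x v - (a1 + t * (b1 - a1)))\<^sup>2 + (y v - (a2 + t * (b2 - a2)))\<^sup>2) \<le> r v"
      by (simp add: a b dist_Pair_Pair dist_real_def)
    \<comment> \<open>\<open>(p, q)\<close> is the vector from a point of \<open>L\<close> in the
      disk to the centre. Moving along \<open>L\<close> does not change the normal component, so
      \<open>y' v\<close> is the normal component of \<open>(p, q)\<close>.\<close>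
    moreover define p q where "p = x v - (a1 + t * (b1 - a1))" and "q = y v - (a2 + t * (b2 - a2))"
    ultimately have "sqrt (p\<^sup>2 + q\<^sup>2) \<le> r v"
      by simp
    have "b1 - a1 = l * d1" "b2 - a2 = l * d2"
      using \<open>l > 0\<close> by (simp_all add: d1_def d2_def)
    then have "y' v = q * d1 - p * d2"
      by (simp add: y'_def p_def q_def algebra_simps)
    then have "(y' v)\<^sup>2 \<le> p\<^sup>2 + q\<^sup>2"
      using rot[of p q] by (metis le_add_same_cancel2 zero_le_power2)
    then have "\<bar>y' v\<bar> \<le> sqrt (p\<^sup>2 + q\<^sup>2)"
      by (metis real_sqrt_abs real_sqrt_le_iff)
    with \<open>sqrt (p\<^sup>2 + q\<^sup>2) \<le> r v\<close> show ?thesis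
      by linarith
  qed
  ultimately show ?thesis
    by (rule that)
qed

section \<open>Quadrants and the clique at the crossing point\<close>

lemma Delta_disk_graph_quadrant:
  assumes "graph G" and rep: "disk_representation G x y r" and "V \<subseteq> verts G"
    and "\<bar>\<sigma>\<bar> = 1" "\<bar>\<tau>\<bar> = 1"
    and V: "\<And>v. v \<in> V \<Longrightarrow> 0 < \<sigma> * x v \<and> 0 < \<tau> * y v \<and> \<bar>x v\<bar> \<le> r v \<and> \<bar>y v\<bar> \<le> r v \<and>
      r v < sqrt ((x v)\<^sup>2 + (y v)\<^sup>2)"
  shows "Delta_disk_graph (G \<restriction> V)"
proof -
  \<comment> \<open>The factors are signs: multiplying by them reflects in the axes, which preserves
    mutual distances as well as distances to the origin.\<close>
  have sq: "(\<sigma> * t)\<^sup>2 = t\<^sup>2" "(\<tau> * t)\<^sup>2 = t\<^sup>2" for t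
    using assms(4,5) by (metis abs_mult mult_1 power2_abs)+
  have le: "\<sigma> * t \<le> \<bar>t\<bar>" "\<tau> * t \<le> \<bar>t\<bar>" for t
    using assms(4,5) by (metis abs_ge_self abs_mult mult_1)+
  have "disk_representation G (\<lambda>v. \<sigma> * x v) (\<lambda>v. \<tau> * y v) r"
    by (rule disk_representation_isometric[OF rep])
      (simp add: dist_Pair_Pair dist_real_def sq flip: right_diff_distrib)
  then have "disk_representation (G \<restriction> V) (\<lambda>v. \<sigma> * x v) (\<lambda>v. \<tau> * y v) r"
    using \<open>V \<subseteq> verts G\<close> by (rule disk_representation_induce_subgraph)
  moreover have "max (\<sigma> * x v) (\<tau> * y v) \<le> r v" if "v \<in> V" for v
    using V[OF that] le(1)[of "x v"] le(2)[of "y v"] by linarith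
  ultimately show ?thesis
    unfolding Delta_disk_graph_def using V graph_induce_subgraph[OF assms(1,3)]
    by (intro conjI exI[of _ "\<lambda>v. \<sigma> * x v"] exI[of _ "\<lambda>v. \<tau> * y v"] exI[of _ r]) (auto simp: sq)
qed

text \<open>Any two of the disks share \<open>p\<close>. Since an edge is a pair of opposite arcs, a
  clique is a complete digraph here.\<close>

lemma complete_digraph_common_point:
  assumes "graph G" and rep: "disk_representation G x y r" and "V \<subseteq> verts G"
    and p: "\<And>v. v \<in> V \<Longrightarrow> p \<in> cball (x v, y v) (r v)"
  shows "complete_digraph (card V) (G \<restriction> V)"
proof -
  interpret graph "G \<restriction> V"
    using assms(1,3) by (rule graph_induce_subgraph)
  have "u \<rightarrow>\<^bsub>G \<restriction> V\<^esub> v" if "u \<in> V" "v \<in> V" "u \<noteq> v" for u v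
    using disk_representation_induce_subgraph[OF rep \<open>V \<subseteq> verts G\<close>] p[of u] p[of v] that
    unfolding disk_representation_def by (metis IntI empty_iff induce_subgraph_verts)
  moreover have "u \<in> V \<and> v \<in> V \<and> u \<noteq> v" if "u \<rightarrow>\<^bsub>G \<restriction> V\<^esub> v" for u v
    using that adj_not_same by (auto simp: dominates_induce_subgraph_iff)
  ultimately have "arcs_ends (G \<restriction> V) = {(u, v). (u, v) \<in> V \<times> V \<and> u \<noteq> v}"
    unfolding set_eq_iff split_paired_All mem_Collect_eq case_prod_conv mem_Times_iff fst_conv snd_conv
    by blast
  then show ?thesis
    using graph_axioms by (simp add: complete_digraph_def)
qed

section \<open>The two separator statements\<close>

lemma disk_graph_separator:
  assumes "disk_graph G"
  shows "\<exists>S. balanced_separator G S \<and> linear_disk_graph (G \<restriction> S)"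
proof -
  obtain x y r where G: "graph G" and rep: "disk_representation G x y r"
    using assms unfolding disk_graph_def by blast
  then obtain c where sep: "balanced_separator G {v \<in> verts G. \<bar>x v - c\<bar> \<le> r v}"
    by (rule balanced_separator_vertical_line)
  define S where "S = {v \<in> verts G. \<bar>x v - c\<bar> \<le> r v}"
  have S: "S \<subseteq> verts G"
    by (auto simp: S_def)
  \<comment> \<open>The witness is the foot of the perpendicular from the centre to the
    line.\<close>
  have "(c, y v) \<in> cball (x v, y v) (r v) \<inter> {p. fst p = c}" if "v \<in> S" for v
    using that by (simp add: S_def dist_Pair_Pair dist_real_def)
  then have "linear_disk_graph (G \<restriction> S)"
    unfolding linear_disk_graph_def
    using graph_induce_subgraph[OF G S] disk_representation_induce_subgraph[OF rep S]
      is_line_vertical[of c]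
    by (metis empty_iff induce_subgraph_verts)
  with sep show ?thesis
    by (auto simp: S_def)
qed

lemma linear_disk_graph_separator:
  fixes G :: "('a, 'b) pre_digraph"
  assumes "linear_disk_graph G"
  shows "\<exists>S. balanced_separator G S \<and>
    (\<exists>V :: nat \<Rightarrow> 'a set.
       (\<Union>i\<in>{1..5}. V i) = S \<and> disjoint_family_on V {1..5} \<and>
       (\<forall>i\<in>{1..4}. Delta_disk_graph (G \<restriction> V i)) \<and>
       complete_digraph (card (V 5)) (G \<restriction> V 5))"
proof -
  have G: "graph G"
    using assms by (simp add: linear_disk_graph_def)
  obtain x0 y r where rep0: "disk_representation G x0 y r"
    and y: "\<And>v. v \<in> verts G \<Longrightarrow> \<bar>y v\<bar> \<le> r v"
    using linear_disk_graph_horizontal[OF assms] by blast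
  obtain c where sep: "balanced_separator G {v \<in> verts G. \<bar>x0 v - c\<bar> \<le> r v}"
    using G rep0 by (rule balanced_separator_vertical_line)
  \<comment> \<open>Translation moves the crossing point of the separating line and the horizontal
    axis to the origin.\<close>
  define x where "x v = x0 v - c" for v
  have rep: "disk_representation G x y r"
    by (rule disk_representation_isometric[OF rep0])
      (simp add: x_def dist_Pair_Pair dist_real_def)
  define S where "S = {v \<in> verts G. \<bar>x v\<bar> \<le> r v}"
  \<comment> \<open>The separating disks that contain the origin.\<close>
  define C where "C = {v \<in> S. sqrt ((x v)\<^sup>2 + (y v)\<^sup>2) \<le> r v}"
  define Q where "Q \<sigma> \<tau> = {v \<in> S - C. 0 < \<sigma> * x v \<and> 0 < \<tau> * y v}" for \<sigma> \<tau>
  define V where "V i = (if i = 1 then Q 1 1 else if i = 2 then Q (-1) 1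
    else if i = 3 then Q (-1) (-1) else if i = 4 then Q 1 (-1) else C)" for i :: nat
  have Q: "Delta_disk_graph (G \<restriction> Q \<sigma> \<tau>)" if "\<bar>\<sigma>\<bar> = 1" "\<bar>\<tau>\<bar> = 1" for \<sigma> \<tau>
    using y that by (intro Delta_disk_graph_quadrant[OF G rep, of _ \<sigma> \<tau>]) (auto simp: Q_def C_def S_def)
  have C: "complete_digraph (card C) (G \<restriction> C)"
    by (rule complete_digraph_common_point[OF G rep, where p = "(0, 0)"])
      (auto simp: C_def S_def dist_Pair_Pair dist_real_def)
  \<comment> \<open>If the centre lies on one axis, its distance to the origin is the absolute value
    of the other coordinate, which is at most \<open>r v\<close>; the disk would then contain the
    origin.\<close>
  have "x v \<noteq> 0 \<and> y v \<noteq> 0" if "v \<in> S - C" for v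
    using that y[of v] by (auto simp: C_def S_def)
  then have "S - C \<subseteq> Q 1 1 \<union> Q (-1) 1 \<union> Q (-1) (-1) \<union> Q 1 (-1)"
    by (force simp: Q_def)
  then have S: "S = Q 1 1 \<union> Q (-1) 1 \<union> Q (-1) (-1) \<union> Q 1 (-1) \<union> C"
    by (auto simp: Q_def C_def)
  have 5: "{1..5::nat} = {1, 2, 3, 4, 5}" "{1..4::nat} = {1, 2, 3, 4}"
    by auto
  have "(\<Union>i\<in>{1..5}. V i) = S"
    unfolding S 5 by (simp add: V_def Un_ac)
  moreover have "disjoint_family_on V {1..5}"
    unfolding disjoint_family_on_def 5 by (auto simp: V_def Q_def)
  moreover have "\<forall>i\<in>{1..4}. Delta_disk_graph (G \<restriction> V i)"
    unfolding 5 by (simp add: V_def Q)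
  moreover have "complete_digraph (card (V 5)) (G \<restriction> V 5)"
    using C by (simp add: V_def)
  ultimately show ?thesis
    using sep by (auto simp: S_def x_def)
qed

theorem theorem17:
  shows "(\<forall>G :: ('a, 'b) pre_digraph. disk_graph G \<longrightarrow>
            (\<exists>S. balanced_separator G S \<and> linear_disk_graph (G \<restriction> S))) \<and>
         (\<forall>G :: ('a, 'b) pre_digraph. linear_disk_graph G \<longrightarrow>
            (\<exists>S. balanced_separator G S \<and>
               (\<exists>V :: nat \<Rightarrow> 'a set.
                  (\<Union>i\<in>{1..5}. V i) = S \<and> disjoint_family_on V {1..5} \<and>
                  (\<forall>i\<in>{1..4}. Delta_disk_graph (G \<restriction> V i)) \<and>
                  complete_digraph (card (V 5)) (G \<restriction> V 5))))"
  by (intro conjI allI impI disk_graph_separator linear_disk_graph_separator)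

end
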